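(* Let $n\ge 3$ and $m\ge 5$ be integers and let $G_{n,m}$ be the grid graph with $n$ rows and $m$ columns. Then $\mathrm{mpd}(G_{n,m})=4$.
   Context: The grid graph $G_{n,m}$ has vertex set $\{(x,y):1\le x\le n,\ 1\le y\le m\}$, with $(x,y)$ and $(x',y')$ adjacent if and only if $|x-x'|+|y-y'|=1$. $d(u,v)$ denotes the shortest-path distance. Let $G$ be a connected graph and let $\Pi=\{S_1,\dots,S_t\}$ be a partition of $V(G)$ into nonempty parts. For $v\in V(G)$ put $d(v,S_i)=\min\{d(v,x):x\in S_i\}$. The multiset partition representation of $v$ with respect to $\Pi$ is the multiset $r_{mp}(v\mid\Pi)=\{d(v,S_1),\dots,d(v,S_t)\}$ (order ignored, multiplicities kept). $\Pi$ is a resolving multiset partition if $r_{mp}(u\mid\Pi)\ne r_{mp}(v\mid\Pi)$ for all distinct $u,v\in V(G)$. The multiset partition dimension $\mathrm{mpd}(G)$ is the minimum number $t$ of parts of a resolving multiset partition of $G$, and $\mathrm{mpd}(G)=\infty$ if none exists. *)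

theory Defs
  imports
    "Graph_Theory.Graph_Theory"
    "HOL-Library.Multiset"
    "HOL-Library.Extended_Nat"
    "HOL-Library.Disjoint_Sets"
begin

text \<open>
  An undirected edge is represented by the two opposite arcs. The record
  type \<open>pair_pre_digraph\<close> is coerced to \<open>pre_digraph\<close> by \<open>with_proj\<close>.
\<close>

definition grid_graph :: "int \<Rightarrow> int \<Rightarrow> (int \<times> int) pair_pre_digraph" where
  "grid_graph n m =
     \<lparr> pverts = {1..n} \<times> {1..m},
       parcs = {((x, y), (x', y')). (x, y) \<in> {1..n} \<times> {1..m} \<and> (x', y') \<in> {1..n} \<times> {1..m} \<and>
                  \<bar>x - x'\<bar> + \<bar>y - y'\<bar> = 1} \<rparr>"

text \<open>
  The remaining notions are meant for a connected \<open>graph\<close> in the sense of the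
  library; that the grid graph is one is proved at the end. With unit weights, the library's
  shortest-path distance is the least number of arcs of a walk.
\<close>

definition graph_dist :: "('a, 'b) pre_digraph \<Rightarrow> 'a \<Rightarrow> 'a \<Rightarrow> ereal" where
  "graph_dist G u v = wf_digraph.\<mu> G (\<lambda>_. 1) u v"

text \<open>
  For nonempty \<open>S\<close> the infimum is attained, as distances are natural numbers (or infinite).
\<close>

definition set_dist :: "('a, 'b) pre_digraph \<Rightarrow> 'a \<Rightarrow> 'a set \<Rightarrow> ereal" where
  "set_dist G v S = (INF x\<in>S. graph_dist G v x)"

definition mp_representation :: "('a, 'b) pre_digraph \<Rightarrow> 'a set set \<Rightarrow> 'a \<Rightarrow> ereal multiset" where
  "mp_representation G P v = image_mset (set_dist G v) (mset_set P)"

definition resolving_multiset_partition :: "('a, 'b) pre_digraph \<Rightarrow> 'a set set \<Rightarrow> bool" where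
  "resolving_multiset_partition G P \<longleftrightarrow>
     finite P \<and> partition_on (verts G) P \<and>
     (\<forall>u\<in>verts G. \<forall>v\<in>verts G. u \<noteq> v \<longrightarrow> mp_representation G P u \<noteq> mp_representation G P v)"

text \<open>The infimum of the empty set of type \<open>enat\<close> is \<open>\<infinity>\<close>.\<close>

definition mpd :: "('a, 'b) pre_digraph \<Rightarrow> enat" where
  "mpd G = (INF P\<in>{P. resolving_multiset_partition G P}. enat (card P))"

lemma pair_graph_grid_graph: "pair_graph (grid_graph n m)"
proof
  show "finite (parcs (grid_graph n m))"
    by (rule finite_subset[of _ "({1..n} \<times> {1..m}) \<times> ({1..n} \<times> {1..m})"])
       (auto simp: grid_graph_def)
  show "symmetric (with_proj (grid_graph n m))"
    by (auto simp: symmetric_def sym_def grid_graph_def arcs_ends_conv abs_minus_commute)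
qed (auto simp: grid_graph_def)

lemma connected_grid_graph:
  assumes "n \<ge> 1" "m \<ge> 1"
  shows "connected (with_proj (grid_graph n m))"
proof -
  interpret pair_graph "grid_graph n m" by (rule pair_graph_grid_graph)
  let ?G = "with_proj (grid_graph n m)"
  have col: "(1, 1) \<rightarrow>\<^sup>*\<^bsub>?G\<^esub> (1 + int k, 1)" if "1 + int k \<le> n" for k
    using that
  proof (induction k)
    case 0
    show ?case unfolding of_nat_0 add_0_right
      by (rule reachable_refl) (use assms in \<open>auto simp: grid_graph_def\<close>)
  next
    case (Suc k)
    have "(1, 1) \<rightarrow>\<^sup>*\<^bsub>?G\<^esub> (1 + int k, 1)" using Suc by simp
    moreover have "(1 + int k, 1) \<rightarrow>\<^bsub>?G\<^esub> (1 + int (Suc k), 1)"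
      using Suc.prems assms by (simp add: grid_graph_def arcs_ends_conv)
    ultimately show ?case by (rule wf_digraph.reachable_adj_trans[OF wf_digraph])
  qed
  have row: "(x, 1) \<rightarrow>\<^sup>*\<^bsub>?G\<^esub> (x, 1 + int k)" if "x \<in> {1..n}" "1 + int k \<le> m" for x k
    using that(2)
  proof (induction k)
    case 0
    show ?case unfolding of_nat_0 add_0_right
      by (rule reachable_refl) (use assms that in \<open>auto simp: grid_graph_def\<close>)
  next
    case (Suc k)
    have "(x, 1) \<rightarrow>\<^sup>*\<^bsub>?G\<^esub> (x, 1 + int k)" using Suc by simp
    moreover have "(x, 1 + int k) \<rightarrow>\<^bsub>?G\<^esub> (x, 1 + int (Suc k))"
      using Suc.prems assms that by (simp add: grid_graph_def arcs_ends_conv)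
    ultimately show ?case by (rule wf_digraph.reachable_adj_trans[OF wf_digraph])
  qed
  have from_corner: "(1, 1) \<rightarrow>\<^sup>*\<^bsub>?G\<^esub> u" if "u \<in> pverts (grid_graph n m)" for u
  proof -
    obtain x y where u: "u = (x, y)" and xy: "1 \<le> x" "x \<le> n" "1 \<le> y" "y \<le> m"
      using \<open>u \<in> _\<close> by (auto simp: grid_graph_def)
    have "(1, 1) \<rightarrow>\<^sup>*\<^bsub>?G\<^esub> (x, 1)" using col[of "nat (x - 1)"] xy by simp
    also have "(x, 1) \<rightarrow>\<^sup>*\<^bsub>?G\<^esub> u" using row[of x "nat (y - 1)"] xy u by simp
    finally show ?thesis .
  qed
  have "u \<rightarrow>\<^sup>*\<^bsub>mk_symmetric ?G\<^esub> v" if "u \<in> verts ?G" "v \<in> verts ?G" for u v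
  proof (rule reachable_mk_symmetricI)
    have "u \<rightarrow>\<^sup>*\<^bsub>?G\<^esub> (1, 1)" using that(1) by (simp add: symmetric_reachable'[OF from_corner])
    also have "(1, 1) \<rightarrow>\<^sup>*\<^bsub>?G\<^esub> v" using that(2) by (simp add: from_corner)
    finally show "u \<rightarrow>\<^sup>*\<^bsub>?G\<^esub> v" .
  qed
  moreover have "verts ?G \<noteq> {}" using assms by (simp add: grid_graph_def)
  ultimately show ?thesis by (simp add: connectedI)
qed

end

theory Submission
  imports Defs
begin

text \<open>
  Three parts never suffice, in any connected graph with at least two vertices. For an edge \<open>bb'\<close>
  between two parts \<open>A\<close> and \<open>B\<close>, the representation of \<open>b\<close> is \<open>{0, 1, L}\<close>, where \<open>L\<close> is its
  distance to the third part \<open>C\<close>. Choose the edge and the endpoint \<open>b \<in> A\<close> with \<open>L\<close> minimal, and let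
  \<open>x \<in> C\<close> be nearest to \<open>b\<close>. By minimality the neighbour of \<open>x\<close> towards \<open>b\<close> lies in \<open>A\<close>, so \<open>b\<close>, \<open>b'\<close>
  and \<open>x\<close> are three vertices whose representations are \<open>{0, 1, L}\<close> or \<open>{0, 1, L + 1}\<close>.

  Four parts suffice for the grid: take the singletons of \<open>(1, 1)\<close>, \<open>(1, 2)\<close> and \<open>(1, m)\<close>, and the rest.
\<close>

section \<open>Graphs with a geodesic distance in the naturals\<close>

text \<open>Replaces the extended real distance by a metric on naturals.
  \<open>geodesic_step\<close> encodes connectedness: it yields the last vertex before
  \<open>v\<close> on a shortest path from \<open>u\<close>.\<close>

locale geodesic_graph =
  fixes G :: "('a, 'b) pre_digraph" and d :: "'a \<Rightarrow> 'a \<Rightarrow> nat"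
  assumes graph_dist_eq: "\<lbrakk>u \<in> verts G; v \<in> verts G\<rbrakk> \<Longrightarrow> graph_dist G u v = ereal (real (d u v))"
    and d_eq_0: "d u v = 0 \<longleftrightarrow> u = v"
    and d_commute: "d u v = d v u"
    and d_triangle: "d u w \<le> d u v + d v w"
    and geodesic_step: "\<lbrakk>u \<in> verts G; v \<in> verts G; u \<noteq> v\<rbrakk> \<Longrightarrow>
      \<exists>w\<in>verts G. d u w + 1 = d u v \<and> d w v = 1"
begin

definition nat_set_dist :: "'a \<Rightarrow> 'a set \<Rightarrow> nat" where
  "nat_set_dist v S = (INF x\<in>S. d v x)"

lemma nat_set_dist_le: "x \<in> S \<Longrightarrow> nat_set_dist v S \<le> d v x"
  unfolding nat_set_dist_def by (simp add: cINF_lower)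

lemma nat_set_dist_attained:
  assumes "S \<noteq> {}"
  obtains x where "x \<in> S" "d v x = nat_set_dist v S"
  using Inf_nat_def1[of "d v ` S"] assms unfolding nat_set_dist_def by fastforce

lemma nat_set_dist_eq_0: "v \<in> S \<Longrightarrow> nat_set_dist v S = 0"
  using nat_set_dist_le[of v S v] d_eq_0[of v v] by simp

lemma nat_set_dist_singleton: "nat_set_dist v {x} = d v x"
  by (simp add: nat_set_dist_def)

lemma nat_set_dist_eq_1:
  assumes "v \<notin> S" "x \<in> S" "d v x = 1"
  shows "nat_set_dist v S = 1"
proof -
  obtain y where "y \<in> S" "d v y = nat_set_dist v S"
    using nat_set_dist_attained[of S v] assms by blast
  moreover have "d v y \<noteq> 0" using \<open>y \<in> S\<close> assms(1) d_eq_0[of v y] by blast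
  ultimately show ?thesis using nat_set_dist_le[OF assms(2), of v] assms(3) by linarith
qed

lemma nat_set_dist_triangle:
  assumes "S \<noteq> {}"
  shows "nat_set_dist w S \<le> d w v + nat_set_dist v S"
proof -
  obtain x where "x \<in> S" "d v x = nat_set_dist v S"
    using nat_set_dist_attained[of S v] assms by blast
  then show "nat_set_dist w S \<le> d w v + nat_set_dist v S"
    using nat_set_dist_le[of x S w] d_triangle[of w x v] by linarith
qed

lemma set_dist_eq:
  assumes "v \<in> verts G" "S \<subseteq> verts G" "S \<noteq> {}"
  shows "set_dist G v S = ereal (real (nat_set_dist v S))"
proof -
  obtain x where x: "x \<in> S" "d v x = nat_set_dist v S"
    using nat_set_dist_attained assms(3) by blast
  show ?thesis
    unfolding set_dist_def
  proof (rule antisym)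
    show "(INF x\<in>S. graph_dist G v x) \<le> ereal (real (nat_set_dist v S))"
      using x assms by (intro INF_lower2[of x]) (auto simp: graph_dist_eq subset_iff)
    show "ereal (real (nat_set_dist v S)) \<le> (INF x\<in>S. graph_dist G v x)"
      using assms by (intro INF_greatest) (auto simp: graph_dist_eq subset_iff nat_set_dist_le)
  qed
qed

text \<open>The embedding of naturals into extended reals is injective, hence so is its action on
  multisets.\<close>

lemma mp_representation_eq_iff:
  assumes "partition_on (verts G) P" "finite P" "u \<in> verts G" "v \<in> verts G"
  shows "mp_representation G P u = mp_representation G P v \<longleftrightarrow>
    image_mset (nat_set_dist u) (mset_set P) = image_mset (nat_set_dist v) (mset_set P)"
proof -
  have rep: "mp_representation G P w =
      image_mset (\<lambda>k. ereal (real k)) (image_mset (nat_set_dist w) (mset_set P))"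
    if "w \<in> verts G" for w
    unfolding mp_representation_def multiset.map_comp
  proof (unfold comp_def, rule image_mset_cong)
    fix S assume "S \<in># mset_set P"
    then have "S \<in> P" using assms(2) by simp
    then have "S \<subseteq> verts G" "S \<noteq> {}"
      using partition_onD1[OF assms(1)] partition_onD3[OF assms(1)] by auto
    with that show "set_dist G w S = ereal (real (nat_set_dist w S))" by (rule set_dist_eq)
  qed
  have "inj (image_mset (\<lambda>k. ereal (real k)))"
    by (intro multiset.inj_map injI) simp
  then show ?thesis
    using rep assms by (simp add: inj_eq)
qed

section \<open>Lower bound: at most three parts never resolve\<close>

text \<open>Take \<open>z\<close> in \<open>S\<close> nearest to \<open>u\<close>. Its predecessor
  on a geodesic from \<open>u\<close> is closer to \<open>u\<close>, hence outside
  \<open>S\<close>.\<close>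

lemma exists_crossing_edge:
  assumes "x \<in> S" "S \<subseteq> verts G" "u \<in> verts G" "u \<notin> S"
  shows "\<exists>w\<in>verts G - S. \<exists>z\<in>S. d w z = 1 \<and>
    d u z = nat_set_dist u S \<and> d u w + 1 = nat_set_dist u S"
proof -
  obtain z where z: "z \<in> S" "d u z = nat_set_dist u S"
    using nat_set_dist_attained assms(1) by blast
  then obtain w where w: "w \<in> verts G" "d u w + 1 = d u z" "d w z = 1"
    using geodesic_step[of u z] assms by blast
  moreover from w z have "w \<notin> S"
    using nat_set_dist_le[of w S u] by auto
  ultimately show ?thesis using z by auto
qed

lemma three_parts_not_resolving:
  assumes P: "partition_on (verts G) P" "card P = 3"
  shows "\<exists>u\<in>verts G. \<exists>v\<in>verts G. u \<noteq> v \<and>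
    image_mset (nat_set_dist u) (mset_set P) = image_mset (nat_set_dist v) (mset_set P)"
proof -
  have P_eq: "P = {A, B, C}" if "A \<in> P" "B \<in> P" "C \<in> P" "A \<noteq> B" "B \<noteq> C" "A \<noteq> C" for A B C
    using that P(2) by (intro card_subset_eq[symmetric] card_ge_0_finite) auto
  have disj: "A = B" if "A \<in> P" "B \<in> P" "x \<in> A" "x \<in> B" for A B x
    using partition_onD2[OF P(1)] that by (auto dest: disjointD)
  have sub: "A \<subseteq> verts G" if "A \<in> P" for A
    using partition_onD1[OF P(1)] that by auto
  have part: "\<exists>A\<in>P. x \<in> A" if "x \<in> verts G" for x
    using partition_onD1[OF P(1)] that by auto
  have ne: "\<exists>x. x \<in> A" if "A \<in> P" for A
    using partition_onD3[OF P(1)] that by (metis ex_in_conv)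
  \<comment> \<open>The parts are ordered, so reversed edges and all choices of the third part
    compete for the same minimum \<open>L\<close>.\<close>
  define crossing where "crossing A B C b b' \<longleftrightarrow> A \<in> P \<and> B \<in> P \<and> C \<in> P \<and> A \<noteq> B \<and> B \<noteq> C \<and> A \<noteq> C \<and>
    b \<in> A \<and> b' \<in> B \<and> d b b' = 1" for A B C b b'
  define L where "L = (LEAST l. \<exists>A B C b b'. crossing A B C b b' \<and> nat_set_dist b C = l)"
  have "\<exists>l A B C b b'. crossing A B C b b' \<and> nat_set_dist b C = l"
  proof -
    obtain X Y Z where XYZ: "P = {X, Y, Z}" "X \<noteq> Y" "Y \<noteq> Z" "X \<noteq> Z"
      using P(2) by (metis card_3_iff)
    obtain x u where "x \<in> X" "u \<in> Y" using ne XYZ by blast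
    moreover from this have "u \<notin> X" "u \<in> verts G" using disj sub XYZ by blast+
    moreover have "X \<subseteq> verts G" using sub XYZ by blast
    ultimately obtain w z where w: "w \<in> verts G" "w \<notin> X" "z \<in> X" "d w z = 1"
      using exists_crossing_edge[of x X u] by (metis DiffE)
    then obtain A where A: "A \<in> P" "w \<in> A" using part by blast
    then have "A \<noteq> X" using w by blast
    then obtain C where "C \<in> P" "C \<noteq> A" "C \<noteq> X" using XYZ A by blast
    with w A \<open>A \<noteq> X\<close> have "crossing A X C w z" by (auto simp: crossing_def XYZ(1))
    then show ?thesis by blast
  qed
  then have "\<exists>A B C b b'. crossing A B C b b' \<and> nat_set_dist b C = L"
    unfolding L_def by (rule LeastI_ex)
  then obtain A B C b b' where c: "crossing A B C b b'" and bC: "nat_set_dist b C = L"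
    by blast
  have min: "L \<le> nat_set_dist v Z" if "crossing X Y Z v v'" for X Y Z v v'
    unfolding L_def using that by (intro Least_le) blast
  from c have ABC: "A \<in> P" "B \<in> P" "C \<in> P" "A \<noteq> B" "B \<noteq> C" "A \<noteq> C"
    and b: "b \<in> A" "b' \<in> B" "d b b' = 1" by (auto simp: crossing_def)
  have notin: "b \<notin> B" "b \<notin> C" "b' \<notin> A" "b' \<notin> C" using disj b ABC by blast+
  have V: "b \<in> verts G" "b' \<in> verts G" using sub ABC b by blast+
  obtain y where "y \<in> C" using ne ABC by blast
  then obtain w x where w: "w \<in> verts G" "w \<notin> C" "x \<in> C" "d w x = 1" "d b x = L" "d b w + 1 = L"
    using exists_crossing_edge[of y C b] sub ABC V notin bC by (metis DiffE)
  have x: "x \<in> verts G" "x \<notin> A" "x \<notin> B" using w disj sub ABC by blast+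
  have "w \<in> A"
  proof (rule ccontr)
    assume "w \<notin> A"
    \<comment> \<open>Otherwise \<open>w\<close> and \<open>x\<close> would form a crossing edge
      with third part \<open>A\<close>, at distance at most \<open>d w b = L - 1\<close> from
      \<open>w\<close>.\<close>
    then have "w \<in> B" using w part P_eq[OF ABC] by blast
    then have "crossing B C A w x" using w ABC by (auto simp: crossing_def)
    then have "L \<le> nat_set_dist w A" by (rule min)
    also have "\<dots> \<le> d w b" using b by (simp add: nat_set_dist_le)
    finally show False using w d_commute[of w b] by simp
  qed
  have rep: "image_mset (nat_set_dist v) (mset_set P) =
      {#nat_set_dist v A, nat_set_dist v B, nat_set_dist v C#}" for v
    using ABC by (simp add: P_eq[OF ABC])
  have rep_b: "image_mset (nat_set_dist b) (mset_set P) = {#0, 1, L#}"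
    unfolding rep using b notin bC by (simp add: nat_set_dist_eq_0 nat_set_dist_eq_1)
  have b'b: "d b' b = 1" and xw: "d x w = 1" using b w d_commute by metis+
  have rep_b': "image_mset (nat_set_dist b') (mset_set P) = {#0, 1, nat_set_dist b' C#}"
    unfolding rep using b b'b notin
    by (simp add: nat_set_dist_eq_0 nat_set_dist_eq_1[of b' A b] add_mset_commute)
  have rep_x: "image_mset (nat_set_dist x) (mset_set P) = {#0, 1, nat_set_dist x B#}"
    unfolding rep using x w xw \<open>w \<in> A\<close>
    by (simp add: nat_set_dist_eq_0 nat_set_dist_eq_1[of x A w] add_mset_commute)
  have "crossing B A C b' b" using ABC b b'b by (simp add: crossing_def)
  then have "L \<le> nat_set_dist b' C" by (rule min)
  moreover have "nat_set_dist b' C \<le> L + 1"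
    using nat_set_dist_triangle[of C b' b] w(3) b'b bC by auto
  moreover have "crossing C A B x w" using ABC w xw \<open>w \<in> A\<close> by (simp add: crossing_def)
  then have "L \<le> nat_set_dist x B" by (rule min)
  moreover have "nat_set_dist x B \<le> L + 1"
    using nat_set_dist_le[OF b(2), of x] d_triangle[of x b' b] d_commute[of x b] b(3) w(5) by simp
  \<comment> \<open>Pigeonhole: the three vertices \<open>b\<close>, \<open>b'\<close>,
    \<open>x\<close> have third entries \<open>L\<close>, \<open>nat_set_dist b' C\<close>,
    \<open>nat_set_dist x B\<close>, all in {L, L + 1}.\<close>
  ultimately consider "nat_set_dist b' C = L" | "nat_set_dist x B = L"
    | "nat_set_dist b' C = nat_set_dist x B" by linarith
  moreover have "b \<noteq> b'" "b \<noteq> x" "b' \<noteq> x" using b x notin by blast+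
  ultimately show ?thesis
    using rep_b rep_b' rep_x V x(1) by cases metis+
qed

text \<open>With one part every representation is {0}; with two parts both ends of an edge between
  them have {0, 1}.\<close>

lemma card_resolving_ge_4:
  assumes P: "resolving_multiset_partition G P" and two: "\<exists>u\<in>verts G. \<exists>v\<in>verts G. u \<noteq> v"
  shows "4 \<le> card P"
proof (rule ccontr)
  assume "\<not> 4 \<le> card P"
  have fin: "finite P" and part: "partition_on (verts G) P"
    using P by (auto simp: resolving_multiset_partition_def)
  have distinct: "image_mset (nat_set_dist u) (mset_set P) \<noteq> image_mset (nat_set_dist v) (mset_set P)"
    if "u \<in> verts G" "v \<in> verts G" "u \<noteq> v" for u v
    using P that mp_representation_eq_iff[OF part fin, of u v]
    by (auto simp: resolving_multiset_partition_def)
  have V: "verts G = \<Union>P" using partition_onD1[OF part] .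
  have "card P \<noteq> 0" using fin V two by auto
  with \<open>\<not> 4 \<le> card P\<close> consider "card P = 1" | "card P = 2" | "card P = 3" by linarith
  then show False
  proof cases
    case 1
    then obtain A where "P = {A}" by (auto simp: card_1_singleton_iff)
    then show False using V two distinct by (auto simp: nat_set_dist_eq_0)
  next
    case 2
    then obtain A B where AB: "P = {A, B}" "A \<noteq> B" by (auto simp: card_2_iff)
    then have disj: "A \<inter> B = {}" using partition_onD2[OF part] by (auto dest: disjointD)
    obtain x u where "x \<in> A" "u \<in> B" using partition_onD3[OF part] AB by blast
    moreover have "A \<subseteq> verts G" "B \<subseteq> verts G" using V AB by auto
    ultimately obtain w z where w: "w \<in> verts G" "w \<notin> A" "z \<in> A" "d w z = 1"
      using exists_crossing_edge[of x A u] disj by (metis DiffE disjoint_iff subsetD)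
    then have "w \<in> B" "z \<notin> B" "z \<in> verts G" "d z w = 1" "w \<noteq> z"
      using V AB disj d_commute[of z w] by auto
    moreover from this w
    have "image_mset (nat_set_dist w) (mset_set P) = image_mset (nat_set_dist z) (mset_set P)"
      using AB by (simp add: nat_set_dist_eq_0 nat_set_dist_eq_1[of w A z] nat_set_dist_eq_1[of z B w])
    ultimately show False using distinct w by blast
  next
    case 3
    then show False using three_parts_not_resolving[OF part] distinct by blast
  qed
qed

end

section \<open>The grid graph\<close>

definition grid_dist :: "int \<times> int \<Rightarrow> int \<times> int \<Rightarrow> nat" where
  "grid_dist u v = nat (\<bar>fst u - fst v\<bar> + \<bar>snd u - snd v\<bar>)"

lemma verts_grid_graph: "verts (with_proj (grid_graph n m)) = {1..n} \<times> {1..m}"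
  by (simp add: grid_graph_def)

lemma pverts_grid_graph: "pverts (grid_graph n m) = {1..n} \<times> {1..m}"
  by (simp add: grid_graph_def)

lemma arcs_grid_graph:
  "(u, v) \<in> arcs (with_proj (grid_graph n m)) \<longleftrightarrow>
    u \<in> {1..n} \<times> {1..m} \<and> v \<in> {1..n} \<times> {1..m} \<and> grid_dist u v = 1"
  by (cases u; cases v) (auto simp: grid_graph_def grid_dist_def)

lemma grid_dist_triangle: "grid_dist u w \<le> grid_dist u v + grid_dist v w"
  unfolding grid_dist_def by linarith

lemma grid_dist_commute: "grid_dist u v = grid_dist v u"
  unfolding grid_dist_def by (simp add: abs_minus_commute)

lemma grid_dist_eq_0: "grid_dist u v = 0 \<longleftrightarrow> u = v"
  unfolding grid_dist_def by (auto simp: prod_eq_iff)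

lemma grid_geodesic_step:
  assumes "u \<in> {1..n} \<times> {1..m}" "v \<in> {1..n} \<times> {1..m}" "u \<noteq> v"
  shows "\<exists>w\<in>{1..n} \<times> {1..m}. grid_dist u w + 1 = grid_dist u v \<and> grid_dist w v = 1"
proof -
  obtain x y x' y' where uv: "u = (x, y)" "v = (x', y')" by (metis surj_pair)
  \<comment> \<open>The neighbour of \<open>v\<close> one step back towards \<open>u\<close>, along
    the first coordinate as long as it differs.\<close>
  define w where "w = (if x < x' then (x' - 1, y') else if x' < x then (x' + 1, y')
    else if y < y' then (x', y' - 1) else (x', y' + 1))"
  have "w \<in> {1..n} \<times> {1..m}" "grid_dist u w + 1 = grid_dist u v" "grid_dist w v = 1"
    using assms by (auto simp: w_def uv grid_dist_def)
  then show ?thesis by blast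
qed

text \<open>By the triangle inequality no walk is cheaper than \<open>grid_dist\<close>; joining
  geodesic steps gives a walk of exactly that cost.\<close>

lemma graph_dist_grid_graph:
  assumes "u \<in> {1..n} \<times> {1..m}" "v \<in> {1..n} \<times> {1..m}"
  shows "graph_dist (with_proj (grid_graph n m)) u v = ereal (real (grid_dist u v))"
proof -
  let ?G = "with_proj (grid_graph n m)"
  interpret pair_graph "grid_graph n m" by (rule pair_graph_grid_graph)
  have lower: "real (grid_dist a b) \<le> awalk_cost (\<lambda>_. 1) p" if "awalk a p b" for a b p
    using that
  proof (induction p arbitrary: a)
    case Nil
    then show ?case by (simp add: awalk_Nil_iff grid_dist_eq_0)
  next
    case (Cons e p)
    then have "e \<in> arcs ?G" "a = fst e" "awalk (snd e) p b"
      by (auto simp: awalk_Cons_iff)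
    moreover from this have "grid_dist a (snd e) = 1"
      using arcs_grid_graph[of "fst e" "snd e" n m] by simp
    ultimately show ?case
      using Cons.IH[of "snd e"] grid_dist_triangle[of a b "snd e"] by simp
  qed
  have upper: "\<exists>p. awalk u p b \<and> awalk_cost (\<lambda>_. 1) p = real k"
    if "b \<in> {1..n} \<times> {1..m}" "grid_dist u b = k" for b k
    using that
  proof (induction k arbitrary: b)
    case 0
    then have "awalk u [] b" using assms by (simp add: awalk_Nil_iff grid_dist_eq_0 pverts_grid_graph)
    then show ?case by (metis awalk_cost_Nil of_nat_0)
  next
    case (Suc k)
    then have "u \<noteq> b" using grid_dist_eq_0[of u b] by auto
    then obtain w where w: "w \<in> {1..n} \<times> {1..m}" "grid_dist u w + 1 = grid_dist u b" "grid_dist w b = 1"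
      using grid_geodesic_step[of u n m b] assms Suc.prems by blast
    then obtain p where p: "awalk u p w" "awalk_cost (\<lambda>_. 1) p = real k"
      using Suc by fastforce
    have "(w, b) \<in> arcs ?G" using w Suc.prems by (simp only: arcs_grid_graph)
    then have "awalk w [(w, b)] b" using arc_implies_awalk by fastforce
    with p have "awalk u (p @ [(w, b)]) b" by (blast intro: awalk_appendI)
    moreover have "awalk_cost (\<lambda>_. 1) (p @ [(w, b)]) = real (Suc k)" using p by simp
    ultimately show ?case by blast
  qed
  obtain p where p: "awalk u p v" "awalk_cost (\<lambda>_. 1) p = real (grid_dist u v)"
    using upper[OF assms(2)] by blast
  show ?thesis
    unfolding graph_dist_def \<mu>_def
  proof (rule antisym)
    show "(INF p\<in>{p. awalk u p v}. ereal (awalk_cost (\<lambda>_. 1) p)) \<le> ereal (real (grid_dist u v))"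
      using p by (intro INF_lower2[of p]) auto
    show "ereal (real (grid_dist u v)) \<le> (INF p\<in>{p. awalk u p v}. ereal (awalk_cost (\<lambda>_. 1) p))"
      using lower by (intro INF_greatest) auto
  qed
qed

lemma geodesic_graph_grid_graph: "geodesic_graph (with_proj (grid_graph n m)) grid_dist"
  by (unfold_locales, unfold verts_grid_graph)
    (rule graph_dist_grid_graph grid_dist_eq_0 grid_dist_commute grid_dist_triangle
      grid_geodesic_step; assumption)+

section \<open>Multisets of distances to three boundary vertices\<close>

text \<open>Spelling out the six matchings turns multiset equations into linear arithmetic.\<close>

lemma mset_3_eq_iff:
  "{#a, b, c#} = {#a', b', c'#} \<longleftrightarrow>
    a = a' \<and> b = b' \<and> c = c' \<or> a = a' \<and> b = c' \<and> c = b' \<or>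
    a = b' \<and> b = a' \<and> c = c' \<or> a = b' \<and> b = c' \<and> c = a' \<or>
    a = c' \<and> b = a' \<and> c = b' \<or> a = c' \<and> b = b' \<and> c = a'" (is "_ \<longleftrightarrow> ?R")
proof
  assume eq: "{#a, b, c#} = {#a', b', c'#}"
  have pair: "p = r \<and> q = s \<or> p = s \<and> q = r" if "{#p, q#} = {#r, s#}" for p q r s :: 'a
    using that by (auto simp: add_eq_conv_ex)
  have "a \<in># {#a', b', c'#}" unfolding eq[symmetric] by simp
  then consider "a = a'" | "a = b'" | "a = c'" by auto
  then show ?R
  proof cases
    case 1
    then show ?thesis using eq pair[of b c b' c'] by auto
  next
    case 2
    then show ?thesis using eq pair[of b c a' c'] by (auto simp: add_mset_commute)
  next
    case 3
    then have "add_mset c' {#b, c#} = add_mset c' {#a', b'#}" using eq by (simp add: add_mset_commute)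
    then show ?thesis using 3 pair[of b c a' b'] by auto
  qed
qed (auto simp: add_mset_commute)

text \<open>With coordinates shifted to start at 0, the entries are the distances to (0, 0), (0, 1)
  and (0, M). The first two differ by 1, and the first and last add up to 2X + M. So parity settles,
  for instance, which entry is the last among three consecutive values. The proof checks all
  matchings.\<close>

lemma grid_corner_dists_inj:
  fixes X Y X' Y' M :: int
  assumes "0 \<le> X" "0 \<le> Y" "Y \<le> M" "0 \<le> X'" "0 \<le> Y'" "Y' \<le> M" "M \<ge> 4"
    and "{#X + Y, X + \<bar>Y - 1\<bar>, X + (M - Y)#} = {#X' + Y', X' + \<bar>Y' - 1\<bar>, X' + (M - Y')#}"
  shows "X = X' \<and> Y = Y'"
proof -
  have abs: "\<bar>Y - 1\<bar> = (if Y = 0 then 1 else Y - 1)" "\<bar>Y' - 1\<bar> = (if Y' = 0 then 1 else Y' - 1)"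
    using assms(2,5) by auto
  show ?thesis
    using assms(8,1-7) unfolding mset_3_eq_iff abs
    by (elim disjE conjE, simp_all split: if_splits) (linarith | presburger)+
qed
text \<open>The first two entries differ by 1, and M - 1 is at least 3. This excludes the multisets
  with two ones; in {1, M, M - 1} it forces the last entry to be 1, so (X, Y) is (0, M - 1) or (1,
  M), and neither fits.\<close>

lemma grid_corner_dists_special:
  fixes X Y M :: int
  assumes "0 \<le> X" "0 \<le> Y" "Y \<le> M" "M \<ge> 4"
    and "X = 0 \<longrightarrow> Y \<notin> {0, 1, M}"
  shows "{#X + Y, X + \<bar>Y - 1\<bar>, X + (M - Y)#} \<notin> {{#1, 1, M#}, {#1, 1, M - 1#}, {#1, M, M - 1#}}"
proof -
  have abs: "\<bar>Y - 1\<bar> = (if Y = 0 then 1 else Y - 1)" using assms(2) by auto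
  show ?thesis
    using assms by (auto simp: mset_3_eq_iff abs split: if_splits)
qed

text \<open>
  The distances from \<open>v\<close> to the parts of the partition, except for one entry \<open>0\<close>, which every
  vertex has for its own part.
\<close>

definition grid_code :: "int \<Rightarrow> int \<times> int \<Rightarrow> int multiset" where
  "grid_code m v =
    (let (x, y) = v in
     if v = (1, 1) then {#1, 1, m - 1#}
     else if v = (1, 2) then {#1, 1, m - 2#}
     else if v = (1, m) then {#1, m - 1, m - 2#}
     else {#x - 1 + (y - 1), x - 1 + \<bar>y - 2\<bar>, x - 1 + (m - y)#})"

lemma grid_code_inj:
  assumes "m \<ge> 5" "u \<in> {1..n} \<times> {1..m}" "v \<in> {1..n} \<times> {1..m}"
    and "grid_code m u = grid_code m v"
  shows "u = v"
proof -
  obtain x y x' y' where uv: "u = (x, y)" "v = (x', y')" by (metis surj_pair)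
  \<comment> \<open>\<open>T\<close> collects the codes of the three singleton parts;
    \<open>f\<close> is the code of every other vertex.\<close>
  define T where "T = {{#1, 1, m - 1#}, {#1, 1, m - 2#}, {#1, m - 1, m - 2#}}"
  define f where "f x y = {#x - 1 + (y - 1), x - 1 + \<bar>y - 2\<bar>, x - 1 + (m - y)#}" for x y
  have T_distinct: "{#1, 1, m - 1#} \<noteq> {#1, 1, m - 2#}" "{#1, 1, m - 1#} \<noteq> {#1, m - 1, m - 2#}"
    "{#1, 1, m - 2#} \<noteq> {#1, m - 1, m - 2#}"
    using assms(1) by (simp_all add: mset_3_eq_iff)
  have f_notin_T: "f a b \<notin> T" if "1 \<le> a" "1 \<le> b" "b \<le> m" "(a, b) \<notin> {(1, 1), (1, 2), (1, m)}" for a b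
    using grid_corner_dists_special[of "a - 1" "b - 1" "m - 1"] that assms(1) by (auto simp: f_def T_def)
  have f_inj: "x = x' \<and> y = y'" if "f x y = f x' y'"
    using grid_corner_dists_inj[of "x - 1" "y - 1" "m - 1" "x' - 1" "y' - 1"] that assms
    unfolding f_def uv by simp
  show ?thesis
    using T_distinct f_notin_T[of x y] f_notin_T[of x' y'] f_inj assms
    unfolding uv grid_code_def f_def[symmetric]
    by (auto simp: T_def split: if_splits)
qed

section \<open>The resolving partition into four parts\<close>

definition grid_partition :: "int \<Rightarrow> int \<Rightarrow> (int \<times> int) set set" where
  "grid_partition n m =
    {{(1, 1)}, {(1, 2)}, {(1, m)}, {1..n} \<times> {1..m} - {(1, 1), (1, 2), (1, m)}}"

lemma grid_partition_resolving:
  fixes n m :: int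
  assumes "n \<ge> 2" "m \<ge> 5"
  shows "resolving_multiset_partition (with_proj (grid_graph n m)) (grid_partition n m)"
    and "card (grid_partition n m) = 4"
proof -
  let ?G = "with_proj (grid_graph n m)"
  interpret geodesic_graph ?G grid_dist by (rule geodesic_graph_grid_graph)
  define R where "R = {1..n} \<times> {1..m} - {(1, 1), (1, 2), (1, m)}"
  \<comment> \<open>A neighbour in \<open>R\<close> for each singleton vertex, which is therefore at
    distance 1 from \<open>R\<close>.\<close>
  have R: "(2, 1) \<in> R" "(2, 2) \<in> R" "(2, m) \<in> R" using assms by (auto simp: R_def)
  have Rne: "R \<noteq> {(1, 1)}" "R \<noteq> {(1, 2)}" "R \<noteq> {(1, m)}" using R by auto
  have P: "grid_partition n m = {{(1, 1)}, {(1, 2)}, {(1, m)}, R}"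
    by (simp add: grid_partition_def R_def)
  show "card (grid_partition n m) = 4" unfolding P using assms Rne by auto
  have part: "partition_on (verts ?G) (grid_partition n m)"
    unfolding verts_grid_graph P
  proof (rule partition_onI)
    show "\<Union> {{(1, 1)}, {(1, 2)}, {(1, m)}, R} = {1..n} \<times> {1..m}"
      using assms by (auto simp: R_def)
    show "{} \<notin> {{(1, 1)}, {(1, 2)}, {(1, m)}, R}" using R(1) by blast
  qed (auto simp: R_def disjnt_def)
  \<comment> \<open>The integers match \<open>grid_code\<close>, where subtraction is not truncated;
    the added 0 is the distance of \<open>v\<close> to its own part.\<close>
  have rep: "image_mset int (image_mset (nat_set_dist v) (mset_set (grid_partition n m))) =
      add_mset 0 (grid_code m v)"
    if "v \<in> verts ?G" for v
  proof -
    have "image_mset (nat_set_dist v) (mset_set (grid_partition n m)) =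
       {#grid_dist v (1, 1), grid_dist v (1, 2), grid_dist v (1, m), nat_set_dist v R#}"
      unfolding P using assms Rne by (auto simp: nat_set_dist_singleton)
    moreover have "nat_set_dist (1, 1) R = 1"
      by (rule nat_set_dist_eq_1[OF _ R(1)]) (auto simp: R_def grid_dist_def)
    moreover have "nat_set_dist (1, 2) R = 1"
      by (rule nat_set_dist_eq_1[OF _ R(2)]) (auto simp: R_def grid_dist_def)
    moreover have "nat_set_dist (1, m) R = 1"
      by (rule nat_set_dist_eq_1[OF _ R(3)]) (auto simp: R_def grid_dist_def)
    moreover have "nat_set_dist v R = 0" if "v \<notin> {(1, 1), (1, 2), (1, m)}"
      using that \<open>v \<in> verts ?G\<close> by (intro nat_set_dist_eq_0) (simp add: R_def pverts_grid_graph)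
    ultimately show ?thesis
      using that assms unfolding verts_grid_graph
      by (cases v) (auto simp: grid_code_def grid_dist_def add_mset_commute)
  qed
  have fin: "finite (grid_partition n m)" by (simp add: grid_partition_def)
  show "resolving_multiset_partition ?G (grid_partition n m)"
    unfolding resolving_multiset_partition_def
  proof (intro conjI ballI impI notI)
    fix u v assume uv: "u \<in> verts ?G" "v \<in> verts ?G" "u \<noteq> v"
      and "mp_representation ?G (grid_partition n m) u = mp_representation ?G (grid_partition n m) v"
    then have "add_mset 0 (grid_code m u) = add_mset 0 (grid_code m v)"
      using mp_representation_eq_iff[OF part fin] rep by metis
    then show False using grid_code_inj[OF assms(2)] uv unfolding verts_grid_graph by auto
  qed (fact fin part)+
qed

section \<open>The dimension of the grid\<close>

theorem theorem3p3:
  fixes n m :: int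
  assumes "n \<ge> 3" and "m \<ge> 5"
  shows "mpd (with_proj (grid_graph n m)) = 4"
proof (rule antisym)
  let ?G = "with_proj (grid_graph n m)"
  interpret geodesic_graph ?G grid_dist by (rule geodesic_graph_grid_graph)
  show "mpd ?G \<le> 4"
    unfolding mpd_def using assms grid_partition_resolving[of n m]
    by (intro INF_lower2[of "grid_partition n m"]) (auto simp: numeral_eq_enat)
  have "(1, 1) \<in> verts ?G" "(1, 2) \<in> verts ?G" using assms unfolding verts_grid_graph by auto
  moreover have "(1 :: int, 1 :: int) \<noteq> (1, 2)" by simp
  ultimately have "\<exists>u\<in>verts ?G. \<exists>v\<in>verts ?G. u \<noteq> v" by blast
  then show "4 \<le> mpd ?G"
    unfolding mpd_def by (intro INF_greatest) (auto simp: numeral_eq_enat card_resolving_ge_4)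
qed

end
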